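(* The Abel equation $$\frac{dy}{dx}=\frac14\,x\,y^3+y^2$$ has infinitely many complex limit cycles between $x=0$ and $x=1$; that is, there are infinitely many $y_0\in\mathbb C\setminus\{0\}$ such that both points $(0,y_0)$ and $(1,y_0)$ lie on the solution curve $$\left\{(x,y)\in\mathbb C^2:\ \frac{y}{xy+2}\,e^{\frac{2}{xy+2}}=\frac{e}{2}\,y_0\right\}.$$
   Context: All variables are complex. The function $\frac{y}{xy+2}e^{2/(xy+2)}$ is a first integral of the equation, and the displayed curve is the level curve through $(0,y_0)$; a "limit cycle" (periodic solution) between $x=0$ and $x=1$ is understood as a solution curve of this form which passes through both $(0,y_0)$ and $(1,y_0)$. *)

theory Defs
  imports "HOL-Analysis.Analysis"
begin

definition solves_on :: "(complex \<Rightarrow> complex \<Rightarrow> complex) \<Rightarrow> complex set \<Rightarrow> (complex \<Rightarrow> complex) \<Rightarrow> bool" where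
  "solves_on f U y \<longleftrightarrow> (\<forall>x\<in>U. (y has_field_derivative f x (y x)) (at x))"

text \<open>A first integral of \<open>dy/dx = f x y\<close> on a region of the \<open>(x,y)\<close>-space: constant along every
  solution whose graph stays in the region, but constant on no nonempty open part of the region.\<close>
definition first_integral ::
  "(complex \<Rightarrow> complex \<Rightarrow> complex) \<Rightarrow> (complex \<times> complex) set \<Rightarrow> (complex \<times> complex \<Rightarrow> complex) \<Rightarrow> bool" where
  "first_integral f D F \<longleftrightarrow>
     (\<forall>U y. open U \<and> connected U \<and> solves_on f U y \<and> (\<forall>x\<in>U. (x, y x) \<in> D)
        \<longrightarrow> (\<lambda>x. F (x, y x)) constant_on U) \<and>
     (\<forall>W. open W \<and> W \<noteq> {} \<and> W \<subseteq> D \<longrightarrow> \<not> F constant_on W)"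

definition abel_rhs :: "complex \<Rightarrow> complex \<Rightarrow> complex" where
  "abel_rhs x y = 1 / 4 * x * y ^ 3 + y ^ 2"

text \<open>The points where the expressions dividing by \<open>xy + 2\<close> are meaningful; membership is
  required explicitly below because division by zero is total in HOL.\<close>
definition abel_domain :: "(complex \<times> complex) set" where
  "abel_domain = {(x, y). x * y + 2 \<noteq> 0}"

definition abel_integral :: "complex \<times> complex \<Rightarrow> complex" where
  "abel_integral = (\<lambda>(x, y). y / (x * y + 2) * exp (2 / (x * y + 2)))"

definition abel_curve :: "complex \<Rightarrow> (complex \<times> complex) set" where
  "abel_curve y0 = {p \<in> abel_domain. abel_integral p = exp 1 / 2 * y0}"

end

(* For y0 = 2 z - 2, the point (1, y0) lies on the curve through (0, y0) as soon as
   exp (1/z) / z = e. The left-hand side has an essential singularity at 0 and omits the value 0,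
   so by the great Picard theorem it takes the value e infinitely often. *)
theory Submission
  imports Defs "HOL-Complex_Analysis.Great_Picard" "HOL-Real_Asymp.Real_Asymp"
begin

text \<open>The prefactor \<open>exp (2 / u x) / u x ^ 3\<close> never vanishes, so the bracket
  alone decides whether the derivative is zero. It is used with u = xy + 2, both along a solution
  and in y at fixed x.\<close>

lemma has_field_derivative_divide_times_exp:
  fixes y u :: "complex \<Rightarrow> complex"
  assumes "(y has_field_derivative y') (at x)" "(u has_field_derivative u') (at x)" "u x \<noteq> 0"
  shows "((\<lambda>x. y x / u x * exp (2 / u x)) has_field_derivative
      exp (2 / u x) / u x ^ 3 * ((y' * u x - y x * u') * u x - 2 * y x * u')) (at x)"
  using assms(3)
  by (auto intro!: derivative_eq_intros assms(1,2) simp: field_simps power3_eq_cube)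

lemma abel_integral_const_along_solution:
  assumes U: "open U" "connected U" and sol: "solves_on abel_rhs U y"
    and D: "\<And>x. x \<in> U \<Longrightarrow> (x, y x) \<in> abel_domain"
  shows "(\<lambda>x. abel_integral (x, y x)) constant_on U"
proof -
  have "((\<lambda>x. abel_integral (x, y x)) has_field_derivative 0) (at x)" if "x \<in> U" for x
  proof -
    have nz: "x * y x + 2 \<noteq> 0" using D[OF that] by (simp add: abel_domain_def)
    have y': "(y has_field_derivative abel_rhs x (y x)) (at x)"
      using sol that by (simp add: solves_on_def)
    define u where "u = (\<lambda>x. x * y x + 2)"
    have "(u has_field_derivative y x + x * abel_rhs x (y x)) (at x)"
      unfolding u_def by (auto intro!: derivative_eq_intros y')
    note has_field_derivative_divide_times_exp[OF y' this]
    \<comment> \<open>Along a solution y' = y^2 (u + 2) / 4 and u' = y u^2 / 4, so y' u^2 and y u'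
      (u + 2) are both y^2 u^2 (u + 2) / 4.\<close>
    moreover have "(abel_rhs x (y x) * u x - y x * (y x + x * abel_rhs x (y x))) * u x
        - 2 * y x * (y x + x * abel_rhs x (y x)) = 0"
      unfolding u_def abel_rhs_def by (simp add: field_simps power2_eq_square power3_eq_cube)
    ultimately show ?thesis using nz by (simp add: abel_integral_def u_def)
  qed
  then show ?thesis
    by (intro has_field_derivative_0_imp_constant_on U)
qed

text \<open>At fixed x, with u = xy + 2, the partial derivative in y is 4 exp(2/u) / u^3, which has
  no zero on the domain; constancy on an open set would force it to be 0.\<close>

lemma abel_integral_not_const_on_open:
  assumes W: "open W" "W \<noteq> {}" "W \<subseteq> abel_domain"
  shows "\<not> abel_integral constant_on W"
proof
  assume "abel_integral constant_on W"
  then obtain c where c: "\<And>p. p \<in> W \<Longrightarrow> abel_integral p = c" by (auto simp: constant_on_def)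
  obtain x y where xy: "(x, y) \<in> W" using W(2) by auto
  define u where "u = x * y + 2"
  have nz: "u \<noteq> 0" using xy W(3) by (auto simp: abel_domain_def u_def)
  have op: "open (Pair x -` W)"
    by (intro open_vimage W continuous_intros)
  have "((\<lambda>t. abel_integral (x, t)) has_field_derivative 0) (at y)"
    using has_field_derivative_transform_within_open[OF DERIV_const op, of y c] xy c by simp
  moreover have "((\<lambda>t. abel_integral (x, t)) has_field_derivative
      exp (2 / u) / u ^ 3 * ((1 * u - y * x) * u - 2 * y * x)) (at y)"
    unfolding u_def abel_integral_def prod.case
    by (rule has_field_derivative_divide_times_exp)
      (use nz in \<open>auto intro!: derivative_eq_intros simp: u_def\<close>)
  ultimately have "0 = exp (2 / u) / u ^ 3 * ((1 * u - y * x) * u - 2 * y * x)"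
    by (rule DERIV_unique)
  also have "(1 * u - y * x) * u - 2 * y * x = 4" by (simp add: u_def algebra_simps)
  finally show False using nz by simp
qed

lemma infinite_solutions_exp_inverse_div:
  fixes c :: complex
  assumes "c \<noteq> 0"
  shows "infinite {z. z \<noteq> 0 \<and> exp (1 / z) / z = c}"
proof -
  define g :: "complex \<Rightarrow> complex" where "g z = exp (1 / z) / z" for z
  have hol: "g holomorphic_on UNIV - {0}"
    unfolding g_def by (intro holomorphic_intros) auto
  have sub: "filterlim complex_of_real (at 0) (at_right 0)"
    "filterlim (\<lambda>x. complex_of_real (- x)) (at 0) (at_right 0)"
    by (auto simp: filterlim_at eventually_at_filter intro!: tendsto_eq_intros)
  \<comment> \<open>A finite limit at 0 is incompatible with the modulus blowing up along a path
    \<open>r\<close> into 0. The absolute value lets the modulus formula hold for all real x,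
    although the \<open>f\<close> used below are negative for x < 0.\<close>
  have no_limit: False
    if "(h \<longlongrightarrow> l) (at 0)" "filterlim r (at 0) (at_right 0)" "\<And>x. norm (h (r x)) = \<bar>f x\<bar>"
      "filterlim f at_top (at_right (0::real))"
    for h r :: "_ \<Rightarrow> complex" and l f
  proof -
    have "((\<lambda>x. \<bar>f x\<bar>) \<longlongrightarrow> norm l) (at_right 0)"
      using tendsto_norm[OF filterlim_compose[OF that(1,2)]] that(3) by simp
    moreover have "filterlim (\<lambda>x. \<bar>f x\<bar>) at_top (at_right 0)"
      by (rule filterlim_at_top_mono[OF that(4)]) (simp add: abs_ge_self)
    ultimately show False
      using not_tendsto_and_filterlim_at_infinity[OF trivial_limit_at_right_real _
          filterlim_at_top_imp_at_infinity] by blast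
  qed
  \<comment> \<open>No removable singularity: \<open>g\<close> is unbounded along the positive
    reals.\<close>
  have non1: "\<not> (g \<longlongrightarrow> l) (at 0)" for l
  proof
    assume "(g \<longlongrightarrow> l) (at 0)"
    then show False
    proof (rule no_limit[OF _ sub(1)])
      show "norm (g (complex_of_real x)) = \<bar>exp (1 / x) / x\<bar>" for x
        by (simp add: g_def norm_divide)
      show "filterlim (\<lambda>x::real. exp (1 / x) / x) at_top (at_right 0)" by real_asymp
    qed
  qed
  \<comment> \<open>No pole: 1/g is unbounded along the negative reals, where 1/g(-x) = -x
    exp(1/x).\<close>
  have non2: "\<not> ((inverse \<circ> g) \<longlongrightarrow> l) (at 0)" for l
  proof
    assume "((inverse \<circ> g) \<longlongrightarrow> l) (at 0)"
    then show False
    proof (rule no_limit[OF _ sub(2)])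
      have "(inverse \<circ> g) (complex_of_real (- x)) = complex_of_real (- (exp (1 / x) * x))" for x
        by (simp add: g_def exp_minus divide_inverse mult.commute flip: exp_of_real)
      then show "norm ((inverse \<circ> g) (complex_of_real (- x))) = \<bar>exp (1 / x) * x\<bar>" for x
        by (metis norm_of_real abs_minus_cancel)
      show "filterlim (\<lambda>x::real. exp (1 / x) * x) at_top (at_right 0)" by real_asymp
    qed
  qed
  obtain a where a: "\<And>w. w \<noteq> a \<Longrightarrow> infinite {z. z \<in> UNIV - {0} \<and> g z = w}"
    using great_Picard_infinite[OF open_UNIV UNIV_I hol non1 non2] by metis
  \<comment> \<open>The omitted value 0 must be the single exceptional value \<open>a\<close>, which
    leaves every nonzero \<open>c\<close>.\<close>
  have "{z. z \<in> UNIV - {0} \<and> g z = 0} = {}" by (auto simp: g_def)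
  then have "a = 0" using a[of 0] by (metis finite.emptyI)
  then show ?thesis using a[of c] assms by (simp add: g_def)
qed

theorem mainTheorem4:
  "first_integral abel_rhs abel_domain abel_integral \<and>
   infinite {y0 :: complex. y0 \<noteq> 0 \<and> (0, y0) \<in> abel_curve y0 \<and> (1, y0) \<in> abel_curve y0}"
proof
  show "first_integral abel_rhs abel_domain abel_integral"
    unfolding first_integral_def
    using abel_integral_const_along_solution abel_integral_not_const_on_open by blast
next
  define S where "S = {z::complex. z \<noteq> 0 \<and> exp (1 / z) / z = exp 1}"
  \<comment> \<open>At x = 0 the curve equation holds for every y0. At x = 1 the denominator is y0 +
    2 = 2z, and cancelling y0/2 leaves exp(1/z) / z = e.\<close>
  let ?f = "\<lambda>z::complex. 2 * z - 2"
  \<comment> \<open>The obvious root z = 1 gives y0 = 0 and is discarded.\<close>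
  have "infinite (S - {1})"
    using infinite_solutions_exp_inverse_div[of "exp 1"] by (simp add: S_def)
  then have "infinite (?f ` (S - {1}))"
    by (subst finite_image_iff) (auto simp: inj_on_def)
  moreover have "?f ` (S - {1}) \<subseteq>
      {y0. y0 \<noteq> 0 \<and> (0, y0) \<in> abel_curve y0 \<and> (1, y0) \<in> abel_curve y0}"
  proof clarify
    fix z assume "z \<in> S" "z \<noteq> 1"
    \<comment> \<open>Here z \<noteq> 0 also puts (1, y0) into \<open>abel_domain\<close>, since y0
      + 2 = 2z.\<close>
    then have "z \<noteq> 0" "exp (1 / z) = z * exp 1" by (auto simp: S_def field_simps)
    then show "?f z \<noteq> 0 \<and> (0, ?f z) \<in> abel_curve (?f z) \<and> (1, ?f z) \<in> abel_curve (?f z)"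
      using \<open>z \<noteq> 1\<close> by (simp add: abel_curve_def abel_domain_def abel_integral_def field_simps)
  qed
  ultimately show
    "infinite {y0 :: complex. y0 \<noteq> 0 \<and> (0, y0) \<in> abel_curve y0 \<and> (1, y0) \<in> abel_curve y0}"
    using finite_subset by blast
qed

end
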